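(* Let $\tau$ be a positive integer, $t=q^\tau$, and let $\alpha\in\mathbb{C}$, $a_1,b_1\in\mathbb{C}^*$ satisfy $|qa_1^{-1}b_1^{-1}|<|q^{\alpha}t^{2i-2}|<1$ for $i=1,\ldots,n$. Then for an arbitrary $x\in\mathbb{C}^*$ (with $b_1x\notin q^{\mathbb{Z}}$) $$I(x,xt,\ldots,xt^{n-1})=\frac{I(x,x,\ldots,x)}{n!}.$$
   Context: Fix $0<q<1$ and an integer $n\ge1$. Put $(a)_\infty=\prod_{i\ge0}(1-q^ia)$, $t=q^\tau$, $$\Phi(z)=\prod_{i=1}^nz_i^\alpha\frac{(qa_1^{-1}z_i)_\infty}{(b_1z_i)_\infty}\prod_{1\le j<k\le n}z_j^{2\tau-1}\frac{(qt^{-1}z_k/z_j)_\infty}{(tz_k/z_j)_\infty},\qquad \Delta(z)=\prod_{1\le i<j\le n}(z_i-z_j),$$ and $I(y)=(1-q)^n\sum_{\nu\in\mathbb{Z}^n}\Phi(yq^\nu)\Delta(yq^\nu)$ with $yq^\nu=(y_1q^{\nu_1},\ldots,y_nq^{\nu_n})$. For $\tau$ a positive integer, $(q^{1-\tau}u)_\infty/(q^\tau u)_\infty$ means $\prod_{l=1-\tau}^{\tau-1}(1-q^lu)$. The right-hand side is the full sum over $\mathbb{Z}^n$. The left-hand side is understood as the continuous extension in $\tau$ from generic non-integer $\tau$: for generic $\tau$ the terms of $I(x,xt,\ldots,xt^{n-1})$ vanish unless $\nu_1\le\nu_2\le\cdots\le\nu_n$, so for integer $\tau$ the left-hand side denotes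 $(1-q)^n$ times the sum of $\Phi\Delta$ at the points $(xq^{\nu_1},xtq^{\nu_2},\ldots,xt^{n-1}q^{\nu_n})$ over $\nu\in\mathbb{Z}^n$ with $\nu_1\le\nu_2\le\cdots\le\nu_n$. Complex powers: fix a logarithm of $x$ and set $(xq^m)^s=x^sq^{sm}$. *)

theory Defs
  imports "HOL-Analysis.Analysis"
begin

text \<open>Points of \<open>(\<complex>\<^sup>*)\<^sup>n\<close> are functions \<^typ>\<open>nat \<Rightarrow> complex\<close> of which only the values at
  \<open>1, \<dots>, n\<close> matter; elements of \<open>\<int>\<^sup>n\<close> are extensional functions on \<open>{1..n}\<close>.\<close>

definition qpoch_inf :: "real \<Rightarrow> complex \<Rightarrow> complex" where
  "qpoch_inf q a = (\<Prod>i. 1 - of_real q ^ i * a)"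

text \<open>The ratio \<open>(q\<^bsup>1-\<tau>\<^esup>u)\<^sub>\<infinity> / (q\<^bsup>\<tau>\<^esup>u)\<^sub>\<infinity>\<close> for a positive integer \<open>\<tau>\<close>, with the common
  factors cancelled, so that it is also meaningful where the denominator vanishes.\<close>

definition qpoch_ratio :: "real \<Rightarrow> nat \<Rightarrow> complex \<Rightarrow> complex" where
  "qpoch_ratio q \<tau> u = (\<Prod>l\<in>{1 - int \<tau>..int \<tau> - 1}. 1 - of_real q powi l * u)"

text \<open>The power \<open>z\<^sup>s\<close> for the branch of the logarithm that takes the value \<open>L\<close> at \<open>x = exp L\<close> and
  is cut along the ray through \<open>-x\<close>: it is \<open>x\<^sup>s (z/x)\<^sup>s\<close> with the principal power of \<open>z/x\<close>. All
  points used below lie on the ray through \<open>x\<close>, where no cut is met.\<close>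

definition branch_powr :: "complex \<Rightarrow> complex \<Rightarrow> complex \<Rightarrow> complex" where
  "branch_powr L z s = exp (s * L) * (z / exp L) powr s"

lemma branch_powr_lattice:
  assumes "0 < q" and "exp L = x"
  shows "branch_powr L (x * of_real q powi m) s = exp (s * L) * of_real q powr (s * of_int m)"
proof -
  have x: "x \<noteq> 0" using assms by auto
  have "ln (q powi m) = of_int m * ln q"
    using assms by (simp add: powr_real_of_int' [symmetric] ln_powr)
  then have "Ln (of_real q powi m) = of_int m * of_real (ln q)"
    using assms Ln_of_real [of "q powi m"] by simp
  then show ?thesis
    using x assms by (simp add: branch_powr_def powr_def Ln_of_real mult.assoc)
qed

definition Phi ::
  "real \<Rightarrow> nat \<Rightarrow> nat \<Rightarrow> complex \<Rightarrow> complex \<Rightarrow> complex \<Rightarrow> complex \<Rightarrow> (nat \<Rightarrow> complex) \<Rightarrow> complex"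
where
  "Phi q n \<tau> \<alpha> a b L z =
     (\<Prod>i\<in>{1..n}. branch_powr L (z i) \<alpha> *
        (qpoch_inf q (of_real q * inverse a * z i) / qpoch_inf q (b * z i))) *
     (\<Prod>(j, k)\<in>{(j, k). 1 \<le> j \<and> j < k \<and> k \<le> n}.
        z j powi (2 * int \<tau> - 1) * qpoch_ratio q \<tau> (z k / z j))"

definition Delta :: "nat \<Rightarrow> (nat \<Rightarrow> complex) \<Rightarrow> complex" where
  "Delta n z = (\<Prod>(i, j)\<in>{(i, j). 1 \<le> i \<and> i < j \<and> j \<le> n}. z i - z j)"

definition int_vectors :: "nat \<Rightarrow> (nat \<Rightarrow> int) set" where
  "int_vectors n = {1..n} \<rightarrow>\<^sub>E UNIV"

definition nondecreasing_int_vectors :: "nat \<Rightarrow> (nat \<Rightarrow> int) set" where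
  "nondecreasing_int_vectors n = {\<nu> \<in> int_vectors n. mono_on {1..n} \<nu>}"

definition qshift :: "real \<Rightarrow> (nat \<Rightarrow> complex) \<Rightarrow> (nat \<Rightarrow> int) \<Rightarrow> nat \<Rightarrow> complex" where
  "qshift q y \<nu> = (\<lambda>i. y i * of_real q powi \<nu> i)"

definition jackson_term ::
  "real \<Rightarrow> nat \<Rightarrow> nat \<Rightarrow> complex \<Rightarrow> complex \<Rightarrow> complex \<Rightarrow> complex \<Rightarrow> (nat \<Rightarrow> complex) \<Rightarrow>
     (nat \<Rightarrow> int) \<Rightarrow> complex"
where
  "jackson_term q n \<tau> \<alpha> a b L y \<nu> =
     Phi q n \<tau> \<alpha> a b L (qshift q y \<nu>) * Delta n (qshift q y \<nu>)"

text \<open>The full integral \<open>I(y)\<close>, summed over \<open>\<int>\<^sup>n\<close>.\<close>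

definition jackson_integral ::
  "real \<Rightarrow> nat \<Rightarrow> nat \<Rightarrow> complex \<Rightarrow> complex \<Rightarrow> complex \<Rightarrow> complex \<Rightarrow> (nat \<Rightarrow> complex) \<Rightarrow> complex"
where
  "jackson_integral q n \<tau> \<alpha> a b L y =
     (1 - of_real q) ^ n * (\<Sum>\<^sub>\<infinity>\<nu>\<in>int_vectors n. jackson_term q n \<tau> \<alpha> a b L y \<nu>)"

text \<open>The value of \<open>I(x, xt, \<dots>, xt\<^bsup>n-1\<^esup>)\<close> extended continuously in \<open>\<tau>\<close> from non-integer \<open>\<tau>\<close>: for
  generic \<open>\<tau>\<close> the terms with \<open>\<nu>\<close> not nondecreasing vanish, whereas for integer \<open>\<tau>\<close> they need
  not, and therefore have to be left out.\<close>

definition truncated_jackson_integral ::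
  "real \<Rightarrow> nat \<Rightarrow> nat \<Rightarrow> complex \<Rightarrow> complex \<Rightarrow> complex \<Rightarrow> complex \<Rightarrow> (nat \<Rightarrow> complex) \<Rightarrow> complex"
where
  "truncated_jackson_integral q n \<tau> \<alpha> a b L y =
     (1 - of_real q) ^ n *
     (\<Sum>\<^sub>\<infinity>\<nu>\<in>nondecreasing_int_vectors n. jackson_term q n \<tau> \<alpha> a b L y \<nu>)"

end

theory Submission
  imports Defs "HOL-Combinatorics.Permutations"
begin

text \<open>After the cancellation in the pair factors, \<open>\<Phi>\<Delta>\<close> on the lattice \<open>z\<^sub>i = x q\<^bsup>m\<^sub>i\<^esup>\<close> is a symmetric
  function of \<open>m \<in> \<int>\<^sup>n\<close> that vanishes as soon as \<open>\<bar>m\<^sub>j - m\<^sub>k\<bar> < \<tau>\<close> for some \<open>j \<noteq> k\<close>. So the full sum is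
  \<open>n!\<close> times the sum over strictly increasing \<open>m\<close>, of which only those with gaps at least \<open>\<tau>\<close>
  contribute; these are exactly \<open>m\<^sub>i = \<nu>\<^sub>i + \<tau>(i - 1)\<close> with \<open>\<nu>\<close> nondecreasing, the points of the truncated sum
  at \<open>(x, xt, \<dots>, xt\<^bsup>n-1\<^esup>)\<close>. Convergence follows by bounding each pair factor by a constant times
  \<open>((1 + \<bar>z\<^sub>j\<bar>)(1 + \<bar>z\<^sub>k\<bar>))\<^bsup>2\<tau>\<^esup>\<close>, which separates the variables and leaves one-variable sums
  with weight \<open>(1 + \<bar>z\<bar>)\<^bsup>2\<tau>(n-1)\<^esup>\<close>, to which the ratio test applies in both directions.\<close>

section \<open>Analytic tools: the infinite q-product, ratio tests over the integers, product
  families\<close>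

lemma qpoch_inf_step:
  assumes "\<bar>q\<bar> < 1"
  shows "qpoch_inf q u = (1 - u) * qpoch_inf q (of_real q * u)"
proof -
  define f where "f u i = 1 - of_real q ^ i * u" for u :: complex and i
  have conv: "convergent_prod (f u)" for u
  proof -
    have "summable (\<lambda>i. \<bar>q\<bar> ^ i * norm u)"
      using assms by (intro summable_mult2 summable_geometric) auto
    then show ?thesis
      by (intro abs_convergent_prod_imp_convergent_prod summable_imp_abs_convergent_prod)
        (simp add: f_def norm_mult norm_power)
  qed
  have step: "(\<Prod>i\<le>Suc k. f u i) = (1 - u) * (\<Prod>i\<le>k. f (of_real q * u) i)" for k
    by (simp add: prod.atMost_Suc_shift f_def mult_ac del: prod.atMost_Suc)
  have "(\<lambda>k. \<Prod>i\<le>Suc k. f u i) \<longlonglongrightarrow> prodinf (f u)"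
    using convergent_prod_LIMSEQ[OF conv] by (rule LIMSEQ_Suc)
  moreover have "(\<lambda>k. \<Prod>i\<le>Suc k. f u i) \<longlonglongrightarrow> (1 - u) * prodinf (f (of_real q * u))"
    unfolding step using convergent_prod_LIMSEQ[OF conv] by (rule tendsto_mult_left)
  ultimately have "prodinf (f u) = (1 - u) * prodinf (f (of_real q * u))"
    by (rule LIMSEQ_unique)
  then show ?thesis
    by (simp add: qpoch_inf_def f_def[abs_def])
qed

lemma summable_norm_ratio_limit:
  fixes f :: "nat \<Rightarrow> 'a::banach"
  assumes "eventually (\<lambda>k. norm (f (Suc k)) = r k * norm (f k)) sequentially"
    and "r \<longlonglongrightarrow> l" and "l < 1"
  shows "summable (\<lambda>k. norm (f k))"
proof -
  obtain c where c: "l < c" "c < 1"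
    using dense[OF \<open>l < 1\<close>] by blast
  have "eventually (\<lambda>k. norm (f (Suc k)) \<le> c * norm (f k)) sequentially"
    using assms(1) order_tendstoD(2)[OF assms(2) c(1)]
    by eventually_elim (simp add: mult_right_mono)
  then obtain N where "\<And>k. k \<ge> N \<Longrightarrow> norm (f (Suc k)) \<le> c * norm (f k)"
    by (auto simp: eventually_sequentially)
  then show ?thesis
    using c by (intro summable_ratio_test[of c N]) auto
qed

text \<open>The two half-lines are handled by separate ratio tests. The ratio \<open>s\<close> is
  taken in the direction of decreasing index, so \<open>l'\<close> governs the tail at minus
  infinity independently of \<open>l\<close>. The index 0 starts both tests and is dropped from the
  second half-line before the two are joined.\<close>

lemma abs_summable_on_int_ratio_limit:
  fixes f :: "int \<Rightarrow> 'a::banach"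
  assumes "eventually (\<lambda>k. norm (f (int k + 1)) = r k * norm (f (int k))) sequentially"
    and "r \<longlonglongrightarrow> l" and "l < 1"
    and "eventually (\<lambda>k. norm (f (- int k - 1)) = s k * norm (f (- int k))) sequentially"
    and "s \<longlonglongrightarrow> l'" and "l' < 1"
  shows "(\<lambda>k. norm (f k)) summable_on UNIV"
proof -
  have "summable (\<lambda>k. norm (f (int k)))"
    using assms(1-3) by (intro summable_norm_ratio_limit) (simp_all add: add.commute)
  then have "(\<lambda>k. norm (f (int k))) summable_on UNIV"
    by (simp add: summable_on_UNIV_nonneg_real_iff)
  moreover have "bij_betw int UNIV {0..}"
    by (rule bij_betwI[of _ _ _ nat]) auto
  ultimately have nonneg: "(\<lambda>k. norm (f k)) summable_on {0..}"
    using summable_on_reindex_bij_betw[of int UNIV "{0..}" "\<lambda>k. norm (f k)"] by simp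
  have "summable (\<lambda>k. norm (f (- int k)))"
  proof (rule summable_norm_ratio_limit)
    have "- int (Suc k) = - int k - 1" for k
      by simp
    then show "eventually (\<lambda>k. norm (f (- int (Suc k))) = s k * norm (f (- int k))) sequentially"
      using assms(4) by (simp only:)
    show "s \<longlonglongrightarrow> l'" "l' < 1"
      by fact+
  qed
  then have "(\<lambda>k. norm (f (- int k))) summable_on UNIV"
    by (simp add: summable_on_UNIV_nonneg_real_iff)
  moreover have "bij_betw (\<lambda>k. - int k) UNIV {..0}"
    by (rule bij_betwI[of _ _ _ "\<lambda>m. nat (- m)"]) auto
  ultimately have "(\<lambda>k. norm (f k)) summable_on {..0}"
    using summable_on_reindex_bij_betw[of "\<lambda>k. - int k" UNIV "{..0}" "\<lambda>k. norm (f k)"] by simp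
  then have "(\<lambda>k. norm (f k)) summable_on {..<0}"
    by (rule summable_on_subset_banach) auto
  with nonneg have "(\<lambda>k. norm (f k)) summable_on ({0..} \<union> {..<0})"
    by (intro summable_on_Un_disjoint) auto
  moreover have "{0..} \<union> {..<0} = (UNIV :: int set)"
    by auto
  ultimately show ?thesis
    by simp
qed

text \<open>For a nonnegative family it suffices to bound the finite partial sums. A finite set of
  functions lies in a finite box, where the sum factors into one-variable sums, each at most the
  full sum of \<open>f\<close>.\<close>

lemma summable_on_prod_PiE:
  fixes f :: "'a \<Rightarrow> real"
  assumes "finite A" and "f summable_on UNIV" and nonneg: "\<And>y. f y \<ge> 0"
  shows "(\<lambda>g. \<Prod>i\<in>A. f (g i)) summable_on (A \<rightarrow>\<^sub>E UNIV)"
proof (rule nonneg_bdd_above_summable_on)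
  show "bdd_above (sum (\<lambda>g. \<Prod>i\<in>A. f (g i)) ` {F. F \<subseteq> (A \<rightarrow>\<^sub>E UNIV) \<and> finite F})"
  proof (rule bdd_aboveI2)
    fix F assume "F \<in> {F. F \<subseteq> (A \<rightarrow>\<^sub>E (UNIV :: 'a set)) \<and> finite F}"
    then have F: "F \<subseteq> A \<rightarrow>\<^sub>E UNIV" "finite F"
      by simp_all
    define B where "B = (\<Union>g\<in>F. g ` A)"
    have B: "finite B"
      unfolding B_def using F(2) assms(1) by (intro finite_UN_I finite_imageI)
    have "F \<subseteq> A \<rightarrow>\<^sub>E B"
    proof
      fix g assume "g \<in> F"
      then show "g \<in> A \<rightarrow>\<^sub>E B"
        using F(1) by (intro PiE_I) (auto simp: B_def dest: PiE_arb)
    qed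
    then have "(\<Sum>g\<in>F. \<Prod>i\<in>A. f (g i)) \<le> (\<Sum>g\<in>A \<rightarrow>\<^sub>E B. \<Prod>i\<in>A. f (g i))"
      using B assms by (intro sum_mono2 finite_PiE prod_nonneg) auto
    also have "\<dots> = (\<Prod>i\<in>A. \<Sum>y\<in>B. f y)"
      using prod_sum_PiE[OF assms(1), of "\<lambda>_. B" "\<lambda>_. f"] B by simp
    also have "\<dots> \<le> (\<Prod>i\<in>A. infsum f UNIV)"
      using B assms by (intro prod_mono conjI sum_nonneg finite_sum_le_infsum) auto
    finally show "(\<Sum>g\<in>F. \<Prod>i\<in>A. f (g i)) \<le> (\<Prod>i\<in>A. infsum f UNIV)" .
  qed
qed (auto intro: prod_nonneg nonneg)

section \<open>The one-variable weight on the lattice x q^m\<close>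

definition lattice_weight :: "real \<Rightarrow> complex \<Rightarrow> complex \<Rightarrow> complex \<Rightarrow> complex \<Rightarrow> complex \<Rightarrow> complex" where
  "lattice_weight q \<alpha> a b L z =
     branch_powr L z \<alpha> * (qpoch_inf q (of_real q * inverse a * z) / qpoch_inf q (b * z))"

text \<open>The power contributes q^\<alpha>, and each of the two q-products loses its first factor.
  The factor 1 - qz/a stays on the left, undivided, because it may vanish on the lattice; 1 - bz has
  to be cancelled, hence the assumption that it is nonzero.\<close>

lemma lattice_weight_step:
  assumes "0 < q" "q < 1" and "exp L = x" and z: "z = x * of_real q powi m" and "b * z \<noteq> 1"
  shows "lattice_weight q \<alpha> a b L (of_real q * z) * (1 - of_real q * inverse a * z) =
         of_real q powr \<alpha> * (1 - b * z) * lattice_weight q \<alpha> a b L z"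
proof -
  have z': "x * of_real q powi (m + 1) = of_real q * z"
    using assms by (simp add: z power_int_add)
  have B: "branch_powr L (of_real q * z) \<alpha> = of_real q powr \<alpha> * branch_powr L z \<alpha>"
    unfolding z'[symmetric] unfolding z branch_powr_lattice[OF assms(1,3)]
    by (simp add: powr_add algebra_simps)
  have num: "qpoch_inf q (of_real q * inverse a * z) =
      (1 - of_real q * inverse a * z) * qpoch_inf q (of_real q * inverse a * (of_real q * z))"
    and den: "qpoch_inf q (b * z) = (1 - b * z) * qpoch_inf q (b * (of_real q * z))"
    using qpoch_inf_step[of q "of_real q * inverse a * z"] qpoch_inf_step[of q "b * z"] assms
    by (simp_all add: mult_ac)
  show ?thesis
    unfolding lattice_weight_def B num den using \<open>b * z \<noteq> 1\<close> by simp
qed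

text \<open>As m tends to infinity, z tends to 0 and the ratio of consecutive terms tends to
  |q^\<alpha>|. As m tends to minus infinity, |z| grows by the factor 1/q in each step, so (1 +
  |z|)^N contributes q^(-N) and the ratio tends to |q/(ab)| / (|q^\<alpha>| q^N). The assumptions
  \<open>upper\<close> and \<open>lower\<close> say that these two limits are below 1.\<close>

lemma lattice_weight_summable:
  assumes q: "0 < q" "q < 1" and x: "exp L = x" and ab: "a \<noteq> 0" "b \<noteq> 0"
    and poles: "\<And>m::int. b * x \<noteq> of_real q powi m"
    and upper: "norm (of_real q powr \<alpha>) < 1"
    and lower: "norm (of_real q * inverse a * inverse b) < norm (of_real q powr \<alpha>) * q ^ N"
  shows "(\<lambda>m. norm (lattice_weight q \<alpha> a b L (x * of_real q powi m)) *
              (1 + norm (x * of_real q powi m)) ^ N) summable_on UNIV"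
proof -
  define Q where "Q = of_real q powr \<alpha>"
  define z where "z m = x * of_real q powi m" for m
  define w where "w m = lattice_weight q \<alpha> a b L (z m)" for m
  define f where "f m = norm (w m) * (1 + norm (z m)) ^ N" for m
  have z_nonzero: "z m \<noteq> 0" for m
    using q x by (auto simp: z_def)
  have Q_nonzero: "Q \<noteq> 0"
    using q by (simp add: Q_def)
  have z_Suc: "z (m + 1) = of_real q * z m" for m
    using q by (simp add: z_def power_int_add)
  have bz: "b * z m \<noteq> 1" for m
  proof
    assume "b * z m = 1"
    then have "b * x = of_real q powi (- m)"
      using q unfolding power_int_minus by (intro inverse_unique[symmetric]) (simp add: z_def mult_ac)
    with poles show False by blast
  qed
  have w_Suc: "w (m + 1) * (1 - of_real q * inverse a * z m) = Q * (1 - b * z m) * w m" for m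
    using lattice_weight_step[OF q x refl, of b m \<alpha> a] bz[of m] by (simp add: w_def Q_def z_Suc z_def[symmetric])
  have norm_z: "1 + norm (z m) > 0" for m
    by (simp add: add_pos_nonneg)
  have q_lim: "(\<lambda>k. of_real q ^ k :: complex) \<longlonglongrightarrow> 0"
    using q by (intro LIMSEQ_power_zero) simp
  have z_lim: "(\<lambda>k. z (int k)) \<longlonglongrightarrow> 0"
    using tendsto_mult_right_zero[OF q_lim, of x] by (simp add: z_def)
  define r where "r k = norm (Q * (1 - b * z (int k)) / (1 - of_real q * inverse a * z (int k))) *
      ((1 + q * norm (z (int k))) / (1 + norm (z (int k)))) ^ N" for k
  have "eventually (\<lambda>k. norm (f (int k + 1)) = r k * norm (f (int k))) sequentially"
  proof -
    \<comment> \<open>The recurrence \<open>w_Suc\<close> determines the next value only where 1 -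
      qz/a is nonzero; as z tends to 0, this holds for all large \<open>k\<close>.\<close>
    have "(\<lambda>k. 1 - of_real q * inverse a * z (int k)) \<longlonglongrightarrow> 1 - of_real q * inverse a * 0"
      by (intro tendsto_intros z_lim)
    then have "eventually (\<lambda>k. 1 - of_real q * inverse a * z (int k) \<noteq> 0) sequentially"
      by (rule tendsto_imp_eventually_ne) simp
    then show ?thesis
    proof eventually_elim
      case (elim k)
      then have "w (int k + 1) = Q * (1 - b * z (int k)) / (1 - of_real q * inverse a * z (int k)) * w (int k)"
        using w_Suc[of "int k"] by (simp add: nonzero_eq_divide_eq)
      then show ?case
        using q norm_z[of "int k"] unfolding f_def r_def z_Suc
        by (simp add: norm_mult norm_divide power_divide)
    qed
  qed
  moreover have "r \<longlonglongrightarrow> norm (Q * (1 - b * 0) / (1 - of_real q * inverse a * 0)) *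
      ((1 + q * norm (0::complex)) / (1 + norm (0::complex))) ^ N"
    unfolding r_def by (intro tendsto_intros z_lim) auto
  then have "r \<longlonglongrightarrow> norm Q"
    by simp
  moreover have "norm Q < 1"
    using upper by (simp add: Q_def)
  moreover
  \<comment> \<open>Near infinity the reciprocal y = 1/z is the convenient variable: it tends to 0,
    and both parts of the ratio, (1 - qz/a) / (Q (1 - bz)) and (1 + |z|) / (1 + q|z|), become
    expressions in y with a finite limit. The index -k - 1 is the point reached by the downward step
    from -k.\<close>
  define y where "y k = inverse (z (- int k - 1))" for k
  have y_lim: "y \<longlonglongrightarrow> 0"
  proof -
    have "y k = of_real q * inverse x * of_real q ^ k" for k
      using q by (simp add: y_def z_def power_int_diff power_int_minus field_simps)
    then show ?thesis
      using tendsto_mult_right_zero[OF q_lim, of "of_real q * inverse x"] by presburger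
  qed
  define s where "s k = norm ((y k - of_real q * inverse a) / (Q * (y k - b))) *
      ((norm (y k) + 1) / (norm (y k) + q)) ^ N" for k
  have "norm (f (- int k - 1)) = s k * norm (f (- int k))" for k
  proof -
    let ?z = "z (- int k - 1)"
    have "- int k - 1 + 1 = - int k"
      by simp
    then have z': "z (- int k) = of_real q * ?z"
      and w': "w (- int k) * (1 - of_real q * inverse a * ?z) = Q * (1 - b * ?z) * w (- int k - 1)"
      using z_Suc[of "- int k - 1"] w_Suc[of "- int k - 1"] by presburger+
    have y: "y k \<noteq> 0" "?z = inverse (y k)" "b \<noteq> y k"
      using z_nonzero[of "- int k - 1"] bz[of "- int k - 1"] by (auto simp: y_def)
    have "w (- int k - 1) = (y k - of_real q * inverse a) / (Q * (y k - b)) * w (- int k)"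
      using w' y Q_nonzero unfolding y(2) by (simp add: field_simps)
    moreover have "1 + norm ?z = (norm (y k) + 1) / (norm (y k) + q) * (1 + q * norm ?z)"
    proof -
      have "1 + norm ?z = (norm (y k) + 1) / norm (y k)" "1 + q * norm ?z = (norm (y k) + q) / norm (y k)"
        using y(1) unfolding y(2) norm_inverse by (simp_all add: field_simps)
      moreover have "norm (y k) + q \<noteq> 0"
        using q norm_ge_zero[of "y k"] by linarith
      ultimately show ?thesis
        by simp
    qed
    ultimately show ?thesis
      using q unfolding f_def s_def z'
      by (simp add: norm_mult norm_divide power_mult_distrib power_divide)
  qed
  then have "eventually (\<lambda>k. norm (f (- int k - 1)) = s k * norm (f (- int k))) sequentially"
    by simp
  moreover have "s \<longlonglongrightarrow> norm ((0 - of_real q * inverse a) / (Q * (0 - b))) *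
      ((norm (0::complex) + 1) / (norm (0::complex) + q)) ^ N"
    unfolding s_def by (intro tendsto_intros y_lim) (use ab Q_nonzero q in auto)
  then have "s \<longlonglongrightarrow> norm (of_real q * inverse a * inverse b) / (norm Q * q ^ N)"
    by (simp add: norm_mult norm_inverse power_mult_distrib power_inverse divide_inverse mult_ac)
  moreover have "norm (of_real q * inverse a * inverse b) / (norm Q * q ^ N) < 1"
    using lower q Q_nonzero by (simp add: Q_def divide_less_eq)
  ultimately have "(\<lambda>m. norm (f m)) summable_on UNIV"
    by (rule abs_summable_on_int_ratio_limit)
  then show ?thesis
    by (simp add: f_def w_def z_def)
qed

section \<open>The pair factors as polynomials\<close>

definition pair_factor :: "real \<Rightarrow> nat \<Rightarrow> complex \<Rightarrow> complex \<Rightarrow> complex" where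
  "pair_factor q \<tau> u v = (u - v) * (\<Prod>l\<in>{1 - int \<tau>..int \<tau> - 1}. u - of_real q powi l * v)"

text \<open>The power of u supplies one u for each of the 2\<tau> - 1 factors 1 - q^l v/u, which
  clears all denominators. The last factor u - v comes from \<Delta>.\<close>

lemma pair_factor_eq:
  assumes "u \<noteq> 0" "\<tau> > 0"
  shows "u powi (2 * int \<tau> - 1) * qpoch_ratio q \<tau> (v / u) * (u - v) = pair_factor q \<tau> u v"
proof -
  have "2 * int \<tau> - 1 = int (card {1 - int \<tau>..int \<tau> - 1})"
    using assms by simp
  then have "u powi (2 * int \<tau> - 1) = (\<Prod>l\<in>{1 - int \<tau>..int \<tau> - 1}. u)"
    by (simp only: power_int_of_nat prod_constant)
  then have "u powi (2 * int \<tau> - 1) * qpoch_ratio q \<tau> (v / u) =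
      (\<Prod>l\<in>{1 - int \<tau>..int \<tau> - 1}. u * (1 - of_real q powi l * (v / u)))"
    by (simp add: qpoch_ratio_def prod.distrib)
  also have "\<dots> = (\<Prod>l\<in>{1 - int \<tau>..int \<tau> - 1}. u - of_real q powi l * v)"
    using assms by (intro prod.cong refl) (simp add: field_simps)
  finally show ?thesis
    by (simp add: pair_factor_def)
qed

text \<open>Each factor satisfies u - q^l v = -q^l (v - q^(-l) u), and the range of l is symmetric
  about 0. The powers q^l multiply to 1, while the odd number 2\<tau> - 1 of signs gives -1, which
  makes up for the sign change of u - v.\<close>

lemma pair_factor_commute:
  assumes "0 < q" "\<tau> > 0"
  shows "pair_factor q \<tau> u v = pair_factor q \<tau> v u"
proof -
  define S where "S = {1 - int \<tau>..int \<tau> - 1}"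
  have reflect: "prod g S = (\<Prod>l\<in>S. g (- l))" for g :: "int \<Rightarrow> 'a::comm_monoid_mult"
    by (rule prod.reindex_bij_witness[of _ uminus uminus]) (auto simp: S_def)
  \<comment> \<open>Reflecting l to -l shows that the product is its own inverse; being positive, it
    equals 1.\<close>
  have "(\<Prod>l\<in>S. q powi l) = inverse (\<Prod>l\<in>S. q powi l)"
    by (subst reflect) (simp add: power_int_minus prod_inversef[symmetric] o_def)
  then have "(\<Prod>l\<in>S. q powi l) * (\<Prod>l\<in>S. q powi l) = 1"
    using assms by (metis power_int_not_zero less_irrefl prod_zero_iff S_def finite_atLeastAtMost_int right_inverse)
  moreover have "(\<Prod>l\<in>S. q powi l) > 0"
    using assms by (intro prod_pos) auto
  ultimately have one: "(\<Prod>l\<in>S. q powi l) = 1"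
    by (metis abs_of_pos abs_one square_eq_1_iff abs_minus_cancel)
  have "(\<Prod>l\<in>S. u - of_real q powi l * v) = (\<Prod>l\<in>S. - of_real (q powi l) * (v - of_real q powi (- l) * u))"
    using assms by (intro prod.cong refl) (simp add: power_int_minus field_simps of_real_power_int)
  also have "\<dots> = (\<Prod>l\<in>S. - of_real (q powi l)) * (\<Prod>l\<in>S. v - of_real q powi (- l) * u)"
    by (rule prod.distrib)
  also have "(\<Prod>l\<in>S. v - of_real q powi (- l) * u) = (\<Prod>l\<in>S. v - of_real q powi l * u)"
    by (rule reflect[symmetric])
  also have "(\<Prod>l\<in>S. - complex_of_real (q powi l)) = (\<Prod>l\<in>S. - 1) * of_real (\<Prod>l\<in>S. q powi l)"
    unfolding of_real_prod prod.distrib[symmetric] by simp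
  also have "(\<Prod>l\<in>S. - 1 :: complex) = - 1"
  proof -
    have "card S = 2 * (\<tau> - 1) + 1"
      using assms by (simp add: S_def)
    then show ?thesis
      by (simp add: power_add power_mult)
  qed
  finally show ?thesis
    unfolding pair_factor_def S_def[symmetric] one by (simp add: algebra_simps)
qed

text \<open>The factor with index l = m - m' vanishes, and this index occurs in the product because
  |l| < \<tau>.\<close>

lemma pair_factor_eq_0:
  assumes "0 < q" "\<tau> > 0" "\<bar>m - m'\<bar> < int \<tau>"
  shows "pair_factor q \<tau> (x * of_real q powi m) (x * of_real q powi m') = 0"
proof -
  have "m - m' \<in> {1 - int \<tau>..int \<tau> - 1}"
    using assms by auto
  moreover have "of_real q powi (m - m') * (x * of_real q powi m') = x * (of_real q powi m :: complex)"
    using assms by (simp add: power_int_diff)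
  ultimately show ?thesis
    unfolding pair_factor_def by (intro mult_eq_0_iff[THEN iffD2] disjI2 prod_zero bexI[of _ "m - m'"]) auto
qed

text \<open>Each of the 2\<tau> linear factors, u - v included, is bounded by a constant times (1 +
  |u|)(1 + |v|). This form of the bound separates the two variables.\<close>

lemma norm_pair_factor_le:
  assumes "0 < q" "\<tau> > 0"
  obtains C where "C > 0" "\<And>u v. norm (pair_factor q \<tau> u v) \<le> C * ((1 + norm u) * (1 + norm v)) ^ (2 * \<tau>)"
proof
  define S where "S = {1 - int \<tau>..int \<tau> - 1}"
  define C where "C = 2 * (\<Prod>l\<in>S. 1 + q powi l)"
  show "C > 0"
    unfolding C_def using assms by (auto intro!: prod_pos add_pos_pos)
  fix u v :: complex
  have factor: "norm (u - of_real c * v) \<le> (1 + c) * ((1 + norm u) * (1 + norm v))" if "c \<ge> 0" for c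
  proof -
    have "norm (u - of_real c * v) \<le> norm u + c * norm v"
      using norm_triangle_ineq4[of u "of_real c * v"] that by (simp add: norm_mult)
    also have "\<dots> \<le> (1 + c) * ((1 + norm u) * (1 + norm v))"
      using that by (simp add: algebra_simps add_nonneg_nonneg)
    finally show ?thesis .
  qed
  have "norm (\<Prod>l\<in>S. u - of_real q powi l * v) \<le> (\<Prod>l\<in>S. (1 + q powi l) * ((1 + norm u) * (1 + norm v)))"
    unfolding prod_norm[symmetric]
    using assms by (intro prod_mono conjI norm_ge_zero)
      (metis factor of_real_power_int zero_le_power_int less_imp_le)
  also have "\<dots> = (\<Prod>l\<in>S. 1 + q powi l) * ((1 + norm u) * (1 + norm v)) ^ card S"
    by (simp add: prod.distrib)
  finally have "norm (\<Prod>l\<in>S. u - of_real q powi l * v) \<le>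
      (\<Prod>l\<in>S. 1 + q powi l) * ((1 + norm u) * (1 + norm v)) ^ card S" .
  moreover have "norm (u - v) \<le> 2 * ((1 + norm u) * (1 + norm v))"
    using factor[of 1] by simp
  ultimately have "norm (pair_factor q \<tau> u v) \<le>
      2 * ((1 + norm u) * (1 + norm v)) * ((\<Prod>l\<in>S. 1 + q powi l) * ((1 + norm u) * (1 + norm v)) ^ card S)"
    unfolding pair_factor_def S_def[symmetric] norm_mult by (intro mult_mono) auto
  also have "\<dots> = C * ((1 + norm u) * (1 + norm v)) ^ Suc (card S)"
    by (simp add: C_def mult_ac)
  also have "Suc (card S) = 2 * \<tau>"
    using assms by (simp add: S_def)
  finally show "norm (pair_factor q \<tau> u v) \<le> C * ((1 + norm u) * (1 + norm v)) ^ (2 * \<tau>)" .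
qed

section \<open>Sorting of integer vectors and sums of symmetric functions\<close>

lemma ex_sorting_permutation:
  fixes m :: "nat \<Rightarrow> 'a::linorder"
  assumes "inj_on m {1..n}"
  obtains \<sigma> where "\<sigma> permutes {1..n}" "strict_mono_on {1..n} (m \<circ> \<sigma>)"
proof -
  define ys where "ys = sort_key m [1..<Suc n]"
  have ys: "distinct ys" "set ys = {1..n}" "length ys = n"
    by (auto simp: ys_def)
  \<comment> \<open>The indices are listed by increasing value of \<open>m\<close>. The shift by one
    occurs because lists count from 0; outside \<open>{1..n}\<close> the map is the identity, as
    \<open>permutes\<close> requires.\<close>
  define \<sigma> where "\<sigma> i = (if i \<in> {1..n} then ys ! (i - 1) else i)" for i
  have "\<sigma> permutes {1..n}"
  proof (rule inj_imp_permutes)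
    show "inj_on \<sigma> {1..n}"
    proof (rule inj_onI)
      fix i j assume "i \<in> {1..n}" "j \<in> {1..n}" "\<sigma> i = \<sigma> j"
      then have "i - 1 = j - 1"
        using nth_eq_iff_index_eq[OF ys(1), of "i - 1" "j - 1"] by (auto simp: \<sigma>_def ys(3))
      then show "i = j"
        using \<open>i \<in> {1..n}\<close> \<open>j \<in> {1..n}\<close> by auto
    qed
    show "\<sigma> i \<in> {1..n}" if "i \<in> {1..n}" for i
    proof -
      have "ys ! (i - 1) \<in> set ys"
        using that ys(3) by (intro nth_mem) auto
      then show ?thesis
        using that ys(2) by (simp add: \<sigma>_def)
    qed
  qed (auto simp: \<sigma>_def)
  moreover have "strict_mono_on {1..n} (m \<circ> \<sigma>)"
  proof (rule strict_mono_onI)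
    fix i j assume ij: "i \<in> {1..n}" "j \<in> {1..n}" "i < j"
    have "sorted_wrt (<) (map m ys)"
      using assms ys(1,2) by (auto simp: strict_sorted_iff distinct_map) (simp add: ys_def)
    then have "map m ys ! (i - 1) < map m ys ! (j - 1)"
      by (rule sorted_wrt_nth_less) (use ij ys(3) in auto)
    then show "(m \<circ> \<sigma>) i < (m \<circ> \<sigma>) j"
      using ij ys(3) by (auto simp: \<sigma>_def)
  qed
  ultimately show thesis
    using that by blast
qed

text \<open>A finite set has only one increasing enumeration. This is what separates the permuted
  copies of the strictly increasing vectors in the next proof.\<close>

lemma strict_mono_on_permuted_unique:
  fixes m m' :: "nat \<Rightarrow> 'a::linorder"
  assumes "strict_mono_on {1..n} m" "strict_mono_on {1..n} m'" "m ` {1..n} = m' ` {1..n}" "i \<in> {1..n}"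
  shows "m i = m' i"
proof -
  have "sorted_wrt (<) (map g [1..<Suc n])" if "strict_mono_on {1..n} g" for g :: "nat \<Rightarrow> 'a"
    unfolding sorted_wrt_map using that
    by (intro sorted_wrt_mono_rel[OF _ sorted_wrt_upt]) (auto intro: strict_mono_onD)
  then have "map m [1..<Suc n] = map m' [1..<Suc n]"
    using assms(1-3) by (intro sorted_distinct_set_unique) (auto simp: strict_sorted_iff atLeastLessThanSuc_atLeastAtMost simp del: upt_Suc)
  then show ?thesis
    using assms(4) by (auto simp: map_eq_conv simp del: upt_Suc)
qed

text \<open>The injective vectors are the disjoint union of n! permuted copies of the set of
  strictly increasing ones. By symmetry \<open>f\<close> has sum \<open>s\<close> on each copy, and
  the vectors with a repeated entry contribute 0.\<close>

lemma has_sum_symmetric_int_vectors: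
  fixes f :: "(nat \<Rightarrow> int) \<Rightarrow> 'a::{real_normed_algebra_1}"
  assumes sym: "\<And>m \<sigma>. m \<in> int_vectors n \<Longrightarrow> \<sigma> permutes {1..n} \<Longrightarrow> f (m \<circ> \<sigma>) = f m"
    and vanish: "\<And>m. m \<in> int_vectors n \<Longrightarrow> \<not> inj_on m {1..n} \<Longrightarrow> f m = 0"
    and sum: "(f has_sum s) {m \<in> int_vectors n. strict_mono_on {1..n} m}"
  shows "(f has_sum (fact n * s)) (int_vectors n)"
proof -
  define M where "M = {m \<in> int_vectors n. strict_mono_on {1..n} m}"
  define P where "P = {\<sigma>. \<sigma> permutes {1..n}}"
  have comp: "m \<circ> \<sigma> \<in> int_vectors n" if "m \<in> int_vectors n" "\<sigma> \<in> P" for m \<sigma>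
    unfolding int_vectors_def
  proof (rule PiE_I)
    fix i assume "i \<notin> {1..n}"
    then show "(m \<circ> \<sigma>) i = undefined"
      using that permutes_not_in[of \<sigma> "{1..n}" i] PiE_arb[of m "{1..n}" "\<lambda>_. UNIV" i]
      by (simp add: int_vectors_def P_def)
  qed simp
  have "(f has_sum s) ((\<lambda>m. m \<circ> \<sigma>) ` M)" if "\<sigma> \<in> P" for \<sigma>
  proof -
    have "inj_on (\<lambda>m. m \<circ> \<sigma>) M"
      using that permutes_surj[of \<sigma>] by (auto simp: inj_on_def P_def fun_eq_iff surj_def) metis
    moreover have "((f \<circ> (\<lambda>m. m \<circ> \<sigma>)) has_sum s) M"
      using sum that unfolding M_def[symmetric]
      by (subst has_sum_cong[where g = f]) (auto simp: sym M_def P_def)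
    ultimately show ?thesis
      by (simp add: has_sum_reindex)
  qed
  moreover have "(\<lambda>m. m \<circ> \<sigma>) ` M \<inter> (\<lambda>m. m \<circ> \<sigma>') ` M = {}" if P: "\<sigma> \<in> P" "\<sigma>' \<in> P" and "\<sigma> \<noteq> \<sigma>'" for \<sigma> \<sigma>'
  proof (rule ccontr)
    assume "\<not> ?thesis"
    then obtain m m' where m: "m \<in> M" "m' \<in> M" "m \<circ> \<sigma> = m' \<circ> \<sigma>'"
      by blast
    \<comment> \<open>Permuting positions keeps the set of values, so \<open>m\<close> and
      \<open>m'\<close> are increasing enumerations of the same set and agree on
      \<open>{1..n}\<close>; injectivity of \<open>m\<close> then forces the permutations to
      agree.\<close>
    have "m ` {1..n} = (m \<circ> \<sigma>) ` {1..n}" "m' ` {1..n} = (m' \<circ> \<sigma>') ` {1..n}"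
      using P unfolding image_comp[symmetric] by (simp_all add: P_def permutes_image)
    with m have eq: "m i = m' i" if "i \<in> {1..n}" for i
      using that strict_mono_on_permuted_unique[of n m m' i] by (simp add: M_def)
    have "\<sigma> i = \<sigma>' i" for i
    proof (cases "i \<in> {1..n}")
      case True
      then have mem: "\<sigma> i \<in> {1..n}" "\<sigma>' i \<in> {1..n}"
        using P permutes_in_image[of _ "{1..n}"] unfolding P_def by blast+
      then have "m (\<sigma> i) = m (\<sigma>' i)"
        using m(3) eq by (metis comp_apply)
      moreover have "inj_on m {1..n}"
        using m(1) by (simp add: M_def strict_mono_on_imp_inj_on)
      ultimately show ?thesis
        using mem by (auto dest: inj_onD)
    next
      case False
      then show ?thesis
        using P permutes_not_in unfolding P_def by (metis mem_Collect_eq)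
    qed
    with \<open>\<sigma> \<noteq> \<sigma>'\<close> show False
      by blast
  qed
  ultimately have "(f has_sum (\<Sum>\<sigma>\<in>P. s)) (\<Union>\<sigma>\<in>P. (\<lambda>m. m \<circ> \<sigma>) ` M)"
    by (intro sum_has_sum) (auto simp: P_def finite_permutations)
  moreover have "(\<Sum>\<sigma>\<in>P. s) = fact n * s"
    using card_permutations[of "{1..n}" n] by (simp add: P_def)
  moreover have "(\<Union>\<sigma>\<in>P. (\<lambda>m. m \<circ> \<sigma>) ` M) = {m \<in> int_vectors n. inj_on m {1..n}}"
  proof (intro equalityI subsetI)
    fix m assume "m \<in> (\<Union>\<sigma>\<in>P. (\<lambda>m. m \<circ> \<sigma>) ` M)"
    then obtain \<sigma> m' where "\<sigma> \<in> P" "m' \<in> M" and m: "m = m' \<circ> \<sigma>"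
      by blast
    moreover then have "inj_on m {1..n}"
      unfolding m by (intro comp_inj_on)
        (auto simp: P_def M_def permutes_inj_on permutes_image intro: strict_mono_on_imp_inj_on)
    ultimately show "m \<in> {m \<in> int_vectors n. inj_on m {1..n}}"
      using comp by (auto simp: M_def)
  next
    fix m assume m: "m \<in> {m \<in> int_vectors n. inj_on m {1..n}}"
    then obtain \<sigma> where \<sigma>: "\<sigma> permutes {1..n}" "strict_mono_on {1..n} (m \<circ> \<sigma>)"
      using ex_sorting_permutation by blast
    then have "m = (m \<circ> \<sigma>) \<circ> inv \<sigma>" "inv \<sigma> \<in> P"
      by (auto simp: P_def permutes_inv comp_assoc permutes_inv_o)
    moreover have "m \<circ> \<sigma> \<in> M"
      using \<sigma> m comp by (auto simp: M_def P_def)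
    ultimately show "m \<in> (\<Union>\<sigma>\<in>P. (\<lambda>m. m \<circ> \<sigma>) ` M)"
      by blast
  qed
  ultimately have "(f has_sum (fact n * s)) {m \<in> int_vectors n. inj_on m {1..n}}"
    by simp
  then show ?thesis
    by (subst has_sum_cong_neutral[where g = f]) (auto simp: vanish)
qed

section \<open>Products over the pairs j < k\<close>

lemma finite_increasing_pairs [simp]: "finite {(j, k). Suc 0 \<le> j \<and> j < k \<and> k \<le> n}"
  by (rule finite_subset[of _ "{1..n} \<times> {1..n}"]) auto

text \<open>A permutation may reverse a pair, so \<open>g\<close> maps a pair to its image put back
  in increasing order. The inverse permutation undoes this, and a symmetric \<open>F\<close> does
  not see the reordering.\<close>

lemma prod_increasing_pairs_permute:
  fixes F :: "nat \<Rightarrow> nat \<Rightarrow> 'a::comm_monoid_mult"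
  assumes sym: "\<And>j k. F j k = F k j" and \<sigma>: "\<sigma> permutes {1..n}"
  shows "(\<Prod>(j, k)\<in>{(j, k). 1 \<le> j \<and> j < k \<and> k \<le> n}. F (\<sigma> j) (\<sigma> k)) =
         (\<Prod>(j, k)\<in>{(j, k). 1 \<le> j \<and> j < k \<and> k \<le> n}. F j k)"
proof -
  define g where "g \<rho> p = (min (\<rho> (fst p)) (\<rho> (snd p)), max (\<rho> (fst p)) (\<rho> (snd p)))"
    for \<rho> :: "nat \<Rightarrow> nat" and p
  have g_pair: "g \<rho> p \<in> {(j, k). 1 \<le> j \<and> j < k \<and> k \<le> n}"
    if p: "p \<in> {(j, k). 1 \<le> j \<and> j < k \<and> k \<le> n}" and \<rho>: "\<rho> permutes {1..n}" for \<rho> p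
  proof -
    obtain j k where jk: "p = (j, k)" "1 \<le> j" "j < k" "k \<le> n"
      using p by auto
    then have "\<rho> j \<in> {1..n}" "\<rho> k \<in> {1..n}" "\<rho> j \<noteq> \<rho> k"
      using permutes_in_image[OF \<rho>] permutes_inj[OF \<rho>] by (auto simp: inj_eq)
    then show ?thesis
      by (auto simp: g_def jk)
  qed
  have g_inverse: "g \<rho> (g \<rho>' p) = p"
    if "p \<in> {(j, k). 1 \<le> j \<and> j < k \<and> k \<le> n}" "\<And>i. \<rho> (\<rho>' i) = i" for \<rho> \<rho>' p
    using that by (auto simp: g_def min_def max_def)
  show ?thesis
    using \<sigma> permutes_inv[OF \<sigma>] permutes_inverses[OF \<sigma>]
    by (intro prod.reindex_bij_witness[of _ "g (inv \<sigma>)" "g \<sigma>"] g_inverse g_pair)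
      (auto simp: g_def min_def max_def sym)
qed

text \<open>Every index lies in n - 1 pairs. Reflecting the second components into the pairs with j
  > k leaves a product over all off-diagonal pairs that involves the first component only.\<close>

lemma prod_increasing_pairs_mult:
  fixes w :: "nat \<Rightarrow> 'a::comm_monoid_mult"
  shows "(\<Prod>(j, k)\<in>{(j, k). 1 \<le> j \<and> j < k \<and> k \<le> n}. w j * w k) = (\<Prod>i\<in>{1..n}. w i ^ (n - 1))"
proof -
  let ?P = "{(j, k). 1 \<le> j \<and> j < k \<and> k \<le> n}"
  let ?R = "{(j, k). 1 \<le> k \<and> k < j \<and> j \<le> n}"
  have fin: "finite ?R"
    by (rule finite_subset[of _ "{1..n} \<times> {1..n}"]) auto
  have "(\<Prod>(j, k)\<in>?P. w j * w k) = (\<Prod>(j, k)\<in>?P. w j) * (\<Prod>(j, k)\<in>?P. w k)"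
    by (simp add: prod.distrib case_prod_unfold)
  also have "(\<Prod>(j, k)\<in>?P. w k) = (\<Prod>(j, k)\<in>?R. w j)"
    by (rule prod.reindex_bij_witness[of _ prod.swap prod.swap]) auto
  also have "(\<Prod>(j, k)\<in>?P. w j) * (\<Prod>(j, k)\<in>?R. w j) = (\<Prod>(j, k)\<in>?P \<union> ?R. w j)"
    using fin by (intro prod.union_disjoint[symmetric]) auto
  also have "?P \<union> ?R = Sigma {1..n} (\<lambda>j. {1..n} - {j})"
    by auto
  also have "(\<Prod>(j, k)\<in>\<dots>. w j) = (\<Prod>j\<in>{1..n}. \<Prod>k\<in>{1..n} - {j}. w j)"
    by (subst prod.Sigma) auto
  finally show ?thesis
    by simp
qed

section \<open>The symmetric summand on the lattice: symmetry, zeros and summability\<close>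

definition lattice_term ::
  "real \<Rightarrow> nat \<Rightarrow> nat \<Rightarrow> complex \<Rightarrow> complex \<Rightarrow> complex \<Rightarrow> complex \<Rightarrow> (nat \<Rightarrow> int) \<Rightarrow> complex"
where
  "lattice_term q n \<tau> \<alpha> a b L m =
     (\<Prod>i\<in>{1..n}. lattice_weight q \<alpha> a b L (exp L * of_real q powi m i)) *
     (\<Prod>(j, k)\<in>{(j, k). 1 \<le> j \<and> j < k \<and> k \<le> n}.
        pair_factor q \<tau> (exp L * of_real q powi m j) (exp L * of_real q powi m k))"

text \<open>The base point \<open>y\<close> is arbitrary so that both sums are covered: constant
  \<open>y\<close> with m = \<nu>, and y_i = x t^(i-1) with m_i = \<nu>_i + \<tau>(i-1).\<close>

lemma jackson_term_eq_lattice_term: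
  assumes "0 < q" "\<tau> > 0"
    and y: "\<And>i. i \<in> {1..n} \<Longrightarrow> y i * of_real q powi \<nu> i = exp L * of_real q powi m i"
  shows "jackson_term q n \<tau> \<alpha> a b L y \<nu> = lattice_term q n \<tau> \<alpha> a b L m"
proof -
  define z where "z = qshift q y \<nu>"
  define v where "v i = exp L * of_real q powi m i" for i
  have z: "z i = v i" "z i \<noteq> 0" if "i \<in> {1..n}" for i
    using y[OF that] assms(1) by (simp_all add: z_def v_def qshift_def)
  have "jackson_term q n \<tau> \<alpha> a b L y \<nu> = (\<Prod>i\<in>{1..n}. lattice_weight q \<alpha> a b L (z i)) *
     (\<Prod>(j, k)\<in>{(j, k). 1 \<le> j \<and> j < k \<and> k \<le> n}.
        z j powi (2 * int \<tau> - 1) * qpoch_ratio q \<tau> (z k / z j) * (z j - z k))"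
    by (simp add: jackson_term_def Phi_def Delta_def z_def lattice_weight_def prod.distrib
        case_prod_unfold mult_ac)
  also have "\<dots> = (\<Prod>i\<in>{1..n}. lattice_weight q \<alpha> a b L (v i)) *
     (\<Prod>(j, k)\<in>{(j, k). 1 \<le> j \<and> j < k \<and> k \<le> n}. pair_factor q \<tau> (v j) (v k))"
    using z assms(2) by (intro arg_cong2[of _ _ _ _ "(*)"] prod.cong refl)
      (auto simp: pair_factor_eq)
  finally show ?thesis
    by (simp add: lattice_term_def v_def)
qed

lemma lattice_term_permute:
  assumes "0 < q" "\<tau> > 0" "\<sigma> permutes {1..n}"
  shows "lattice_term q n \<tau> \<alpha> a b L (m \<circ> \<sigma>) = lattice_term q n \<tau> \<alpha> a b L m"
proof -
  define v where "v i = exp L * of_real q powi m i" for i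
  have "(\<Prod>i\<in>{1..n}. lattice_weight q \<alpha> a b L (v (\<sigma> i))) = (\<Prod>i\<in>{1..n}. lattice_weight q \<alpha> a b L (v i))"
    using prod.permute[OF assms(3), of "\<lambda>i. lattice_weight q \<alpha> a b L (v i)"] by (simp add: o_def)
  moreover have "(\<Prod>(j, k)\<in>{(j, k). 1 \<le> j \<and> j < k \<and> k \<le> n}. pair_factor q \<tau> (v (\<sigma> j)) (v (\<sigma> k))) =
      (\<Prod>(j, k)\<in>{(j, k). 1 \<le> j \<and> j < k \<and> k \<le> n}. pair_factor q \<tau> (v j) (v k))"
    by (intro prod_increasing_pairs_permute pair_factor_commute assms)
  ultimately show ?thesis
    by (simp add: lattice_term_def v_def)
qed

lemma lattice_term_eq_0:
  assumes "0 < q" "\<tau> > 0" "1 \<le> j" "j < k" "k \<le> n" "\<bar>m j - m k\<bar> < int \<tau>"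
  shows "lattice_term q n \<tau> \<alpha> a b L m = 0"
proof -
  have "(\<Prod>(j, k)\<in>{(j, k). 1 \<le> j \<and> j < k \<and> k \<le> n}.
        pair_factor q \<tau> (exp L * of_real q powi m j) (exp L * of_real q powi m k)) = 0"
    using assms by (intro prod_zero bexI[of _ "(j, k)"]) (auto simp: pair_factor_eq_0)
  then show ?thesis
    by (simp add: lattice_term_def)
qed

lemma lattice_term_summable:
  assumes q: "0 < q" "q < 1" and "\<tau> > 0" and ab: "a \<noteq> 0" "b \<noteq> 0"
    and poles: "\<And>m::int. b * exp L \<noteq> of_real q powi m"
    and upper: "norm (of_real q powr \<alpha>) < 1"
    and lower: "norm (of_real q * inverse a * inverse b) < norm (of_real q powr \<alpha>) * q ^ (2 * \<tau> * (n - 1))"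
  shows "lattice_term q n \<tau> \<alpha> a b L summable_on int_vectors n"
proof -
  let ?P = "{(j, k). 1 \<le> j \<and> j < k \<and> k \<le> n}"
  define z where "z m = exp L * of_real q powi m" for m
  \<comment> \<open>Each of the n - 1 pairs containing a given variable contributes the exponent
    2\<tau> to its weight; this is the exponent of q in \<open>lower\<close>.\<close>
  define w where "w m = norm (lattice_weight q \<alpha> a b L (z m)) * (1 + norm (z m)) ^ (2 * \<tau> * (n - 1))" for m
  obtain C where C: "C > 0"
    "\<And>u v. norm (pair_factor q \<tau> u v) \<le> C * ((1 + norm u) * (1 + norm v)) ^ (2 * \<tau>)"
    using norm_pair_factor_le[OF q(1) \<open>\<tau> > 0\<close>] by blast
  have "w summable_on UNIV"
    unfolding w_def z_def by (rule lattice_weight_summable[OF q refl ab poles upper lower])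
  moreover have "w m \<ge> 0" for m
    by (simp add: w_def)
  ultimately have "(\<lambda>m. \<Prod>i\<in>{1..n}. w (m i)) summable_on int_vectors n"
    unfolding int_vectors_def by (intro summable_on_prod_PiE) auto
  then have "(\<lambda>m. C ^ card ?P * (\<Prod>i\<in>{1..n}. w (m i))) summable_on int_vectors n"
    by (rule summable_on_cmult_right)
  moreover have "norm (lattice_term q n \<tau> \<alpha> a b L m) \<le> C ^ card ?P * (\<Prod>i\<in>{1..n}. w (m i))" for m
  proof -
    have "norm (\<Prod>(j, k)\<in>?P. pair_factor q \<tau> (z (m j)) (z (m k))) \<le>
        (\<Prod>(j, k)\<in>?P. C * ((1 + norm (z (m j))) * (1 + norm (z (m k)))) ^ (2 * \<tau>))"
      unfolding prod_norm[symmetric] using C(2) by (intro prod_mono) auto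
    also have "\<dots> = C ^ card ?P * (\<Prod>(j, k)\<in>?P. (1 + norm (z (m j))) ^ (2 * \<tau>) * (1 + norm (z (m k))) ^ (2 * \<tau>))"
      by (simp add: case_prod_unfold prod.distrib power_mult_distrib)
    also have "\<dots> = C ^ card ?P * (\<Prod>i\<in>{1..n}. (1 + norm (z (m i))) ^ (2 * \<tau> * (n - 1)))"
      unfolding prod_increasing_pairs_mult by (simp only: power_mult)
    finally have "norm (lattice_term q n \<tau> \<alpha> a b L m) \<le>
        (\<Prod>i\<in>{1..n}. norm (lattice_weight q \<alpha> a b L (z (m i)))) *
        (C ^ card ?P * (\<Prod>i\<in>{1..n}. (1 + norm (z (m i))) ^ (2 * \<tau> * (n - 1))))"
      unfolding lattice_term_def z_def[symmetric] norm_mult prod_norm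
      by (intro mult_left_mono) auto
    then show ?thesis
      by (simp add: w_def prod.distrib mult_ac)
  qed
  ultimately have "(\<lambda>m. norm (lattice_term q n \<tau> \<alpha> a b L m)) summable_on int_vectors n"
    by (rule Infinite_Sum.abs_summable_on_comparison_test')
  then show ?thesis
    by (rule abs_summable_summable)
qed

section \<open>From nondecreasing vectors to strictly increasing ones\<close>

lemma ex_descent_if_not_mono_on:
  fixes g :: "nat \<Rightarrow> 'a::linorder"
  assumes "\<not> mono_on {1..n} g"
  obtains i where "1 \<le> i" "i < n" "g (Suc i) < g i"
proof (rule ccontr)
  assume "\<not> thesis"
  with that have adjacent: "g i \<le> g (Suc i)" if "1 \<le> i" "i < n" for i
    using that not_less by blast
  have "g i \<le> g j" if "1 \<le> i" "i \<le> j" "j \<le> n" for i j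
    using that(2,3)
  proof (induction rule: dec_induct)
    case (step j)
    then have "g i \<le> g j" "g j \<le> g (Suc j)"
      using \<open>1 \<le> i\<close> adjacent[of j] by simp_all
    then show ?case
      by (rule order_trans)
  qed simp
  then have "mono_on {1..n} g"
    by (intro mono_onI) auto
  with assms show False
    by simp
qed

text \<open>Adding \<tau>(i-1) to the i-th entry maps the nondecreasing vectors bijectively onto the
  set \<open>T\<close> of vectors whose consecutive gaps are at least \<tau>. Any other strictly
  increasing vector has two neighbouring entries closer than \<tau>, where \<open>f\<close>
  vanishes.\<close>

lemma has_sum_nondecreasing_shift:
  fixes f :: "(nat \<Rightarrow> int) \<Rightarrow> 'a::real_normed_vector"
  assumes "\<tau> > 0"
    and shift: "\<And>\<nu> m. (\<And>i. i \<in> {1..n} \<Longrightarrow> m i = \<nu> i + int \<tau> * int (i - 1)) \<Longrightarrow> g \<nu> = f m"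
    and vanish: "\<And>m j k. 1 \<le> j \<Longrightarrow> j < k \<Longrightarrow> k \<le> n \<Longrightarrow> \<bar>m j - m k\<bar> < int \<tau> \<Longrightarrow> f m = 0"
  shows "(g has_sum s) (nondecreasing_int_vectors n) \<longleftrightarrow>
         (f has_sum s) {m \<in> int_vectors n. strict_mono_on {1..n} m}"
proof -
  \<comment> \<open>The restriction keeps the result extensional, and the signed parameter lets
    \<open>h (- c)\<close> serve as the inverse of \<open>h c\<close> on
    \<open>int_vectors n\<close>.\<close>
  define h where "h c \<nu> = (\<lambda>i\<in>{1..n}. \<nu> i + c * int (i - 1))" for c :: int and \<nu> :: "nat \<Rightarrow> int"
  define T where "T = {m \<in> int_vectors n. mono_on {1..n} (\<lambda>i. m i - int \<tau> * int (i - 1))}"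
  have h_mem: "h c \<nu> \<in> int_vectors n" for c \<nu>
    by (auto simp: h_def int_vectors_def)
  have h_inverse: "h c (h (- c) m) = m" if "m \<in> int_vectors n" for c m
  proof -
    have "h c (h (- c) m) = restrict m {1..n}"
      by (auto simp: h_def)
    also have "\<dots> = m"
      using that unfolding int_vectors_def by (rule PiE_restrict)
    finally show ?thesis .
  qed
  have "(g has_sum s) (nondecreasing_int_vectors n) \<longleftrightarrow> (f has_sum s) T"
  proof (rule has_sum_reindex_bij_witness[where i = "h (- int \<tau>)" and j = "h (int \<tau>)"])
    fix \<nu> assume \<nu>: "\<nu> \<in> nondecreasing_int_vectors n"
    then show "h (- int \<tau>) (h (int \<tau>) \<nu>) = \<nu>"
      using h_inverse[of \<nu> "- int \<tau>"] by (simp add: nondecreasing_int_vectors_def)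
    show "h (int \<tau>) \<nu> \<in> T"
      using \<nu> h_mem[of "int \<tau>" \<nu>] by (auto simp: T_def h_def nondecreasing_int_vectors_def mono_on_def)
    show "f (h (int \<tau>) \<nu>) = g \<nu>"
      by (rule shift[symmetric]) (simp add: h_def)
  next
    fix m assume m: "m \<in> T"
    then show "h (int \<tau>) (h (- int \<tau>) m) = m"
      using h_inverse by (simp add: T_def)
    show "h (- int \<tau>) m \<in> nondecreasing_int_vectors n"
      using m h_mem[of "- int \<tau>" m] by (auto simp: T_def h_def nondecreasing_int_vectors_def mono_on_def)
  qed simp
  also have "\<dots> \<longleftrightarrow> (f has_sum s) {m \<in> int_vectors n. strict_mono_on {1..n} m}"
  proof (rule has_sum_cong_neutral)
    fix m assume "m \<in> {m \<in> int_vectors n. strict_mono_on {1..n} m} - T"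
    then have strict: "strict_mono_on {1..n} m"
      and "\<not> mono_on {1..n} (\<lambda>i. m i - int \<tau> * int (i - 1))"
      by (auto simp: T_def)
    \<comment> \<open>Monotonicity already fails between neighbours, where the failure says that the
      gap of \<open>m\<close> is less than \<tau>.\<close>
    then obtain i where i: "1 \<le> i" "i < n" "m (Suc i) - int \<tau> * int i < m i - int \<tau> * int (i - 1)"
      by (elim ex_descent_if_not_mono_on) auto
    then have "m (Suc i) - m i < int \<tau>"
      by (simp add: of_nat_diff algebra_simps)
    moreover have "m i < m (Suc i)"
      using i strict by (auto intro: strict_mono_onD)
    ultimately show "f m = 0"
      using i by (intro vanish[of i "Suc i"]) auto
  next
    fix m assume "m \<in> T - {m \<in> int_vectors n. strict_mono_on {1..n} m}"
    \<comment> \<open>As \<tau> > 0, gaps of at least \<tau> are strict increases, so there is no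
      such \<open>m\<close>.\<close>
    moreover have "strict_mono_on {1..n} m" if "m \<in> T"
    proof (rule strict_mono_onI)
      fix i j assume ij: "i \<in> {1..n}" "j \<in> {1..n}" "i < j"
      then have "m i - int \<tau> * int (i - 1) \<le> m j - int \<tau> * int (j - 1)"
        using that by (auto simp: T_def dest!: mono_onD[of _ _ i j])
      moreover have "int \<tau> * int (i - 1) < int \<tau> * int (j - 1)"
        using ij \<open>\<tau> > 0\<close> by (intro mult_strict_left_mono) auto
      ultimately show "m i < m j"
        by linarith
    qed
    ultimately show "f m = 0"
      by (auto simp: T_def)
  qed simp
  finally show ?thesis .
qed

section \<open>Comparison of the two Jackson sums\<close>

theorem lemma3p2:
  fixes q t :: real and n \<tau> :: nat and \<alpha> a\<^sub>1 b\<^sub>1 x L :: complex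
  assumes "0 < q" and "q < 1" and "n \<ge> 1"
    and "\<tau> > 0" and "t = q ^ \<tau>"
    and "a\<^sub>1 \<noteq> 0" and "b\<^sub>1 \<noteq> 0"
    and "\<forall>i\<in>{1..n}.
           norm (of_real q * inverse a\<^sub>1 * inverse b\<^sub>1) < norm (of_real q powr \<alpha> * of_real t ^ (2 * i - 2)) \<and>
           norm (of_real q powr \<alpha> * of_real t ^ (2 * i - 2)) < 1"
    and "x \<noteq> 0" and "\<forall>m::int. b\<^sub>1 * x \<noteq> of_real q powi m"
    and "exp L = x"
  shows "jackson_term q n \<tau> \<alpha> a\<^sub>1 b\<^sub>1 L (\<lambda>i. x * of_real t ^ (i - 1))
           summable_on nondecreasing_int_vectors n \<and>
         jackson_term q n \<tau> \<alpha> a\<^sub>1 b\<^sub>1 L (\<lambda>i. x) summable_on int_vectors n \<and>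
         truncated_jackson_integral q n \<tau> \<alpha> a\<^sub>1 b\<^sub>1 L (\<lambda>i. x * of_real t ^ (i - 1)) =
         jackson_integral q n \<tau> \<alpha> a\<^sub>1 b\<^sub>1 L (\<lambda>i. x) / fact n"
proof -
  let ?f = "lattice_term q n \<tau> \<alpha> a\<^sub>1 b\<^sub>1 L"
  \<comment> \<open>The case i = 1 of the upper bound, where t has exponent 0.\<close>
  have "norm (of_real q powr \<alpha>) < 1"
    using assms(3,8) by (auto dest: bspec[of _ _ 1])
  \<comment> \<open>The case i = n of the lower bound, where t^(2n-2) = q^(2\<tau>(n-1)) is the
    power of q required for convergence.\<close>
  moreover have "norm (of_real q * inverse a\<^sub>1 * inverse b\<^sub>1) < norm (of_real q powr \<alpha>) * q ^ (2 * \<tau> * (n - 1))"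
  proof -
    have "t ^ (2 * n - 2) = q ^ (2 * \<tau> * (n - 1))"
    proof -
      have "2 * n - 2 = 2 * (n - 1)"
        by simp
      then show ?thesis
        using assms(5) by (simp only: power_mult[symmetric] mult_ac)
    qed
    moreover have "norm (of_real q * inverse a\<^sub>1 * inverse b\<^sub>1) < norm (of_real q powr \<alpha> * of_real t ^ (2 * n - 2))"
      using assms(3,8) by auto
    ultimately show ?thesis
      using assms(1) by (simp add: norm_mult flip: of_real_power)
  qed
  ultimately have summable: "?f summable_on int_vectors n"
    using assms by (intro lattice_term_summable) auto
  then have "?f summable_on {m \<in> int_vectors n. strict_mono_on {1..n} m}"
    by (rule summable_on_subset_banach) auto
  \<comment> \<open>The number \<open>s\<close> links both sides: the full sum will be n! times
    \<open>s\<close>, the truncated sum \<open>s\<close> itself.\<close>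
  then obtain s where s: "(?f has_sum s) {m \<in> int_vectors n. strict_mono_on {1..n} m}"
    by (auto simp: summable_on_def)
  have "(?f has_sum (fact n * s)) (int_vectors n)"
  proof (rule has_sum_symmetric_int_vectors[OF _ _ s])
    fix m :: "nat \<Rightarrow> int" assume "\<not> inj_on m {1..n}"
    then obtain j k where "j \<in> {1..n}" "k \<in> {1..n}" "j < k" "m j = m k"
      unfolding inj_on_def by (metis linorder_neqE_nat)
    then show "?f m = 0"
      using assms(1,4) by (intro lattice_term_eq_0[of _ _ j k]) auto
  qed (use assms lattice_term_permute in auto)
  moreover have "jackson_term q n \<tau> \<alpha> a\<^sub>1 b\<^sub>1 L (\<lambda>i. x) = ?f"
    using assms by (intro ext jackson_term_eq_lattice_term) auto
  ultimately have full: "(jackson_term q n \<tau> \<alpha> a\<^sub>1 b\<^sub>1 L (\<lambda>i. x) has_sum (fact n * s)) (int_vectors n)"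
    by simp
  have "(jackson_term q n \<tau> \<alpha> a\<^sub>1 b\<^sub>1 L (\<lambda>i. x * of_real t ^ (i - 1)) has_sum s)
      (nondecreasing_int_vectors n) \<longleftrightarrow> (?f has_sum s) {m \<in> int_vectors n. strict_mono_on {1..n} m}"
  proof (rule has_sum_nondecreasing_shift[OF \<open>\<tau> > 0\<close>])
    fix \<nu> m :: "nat \<Rightarrow> int" assume m: "\<And>i. i \<in> {1..n} \<Longrightarrow> m i = \<nu> i + int \<tau> * int (i - 1)"
    \<comment> \<open>Since t^(i-1) = q^(\<tau>(i-1)), the factor t^(i-1) in the base point is
      absorbed into the exponent of q.\<close>
    have "x * of_real t ^ (i - 1) * of_real q powi \<nu> i = exp L * of_real q powi m i" if "i \<in> {1..n}" for i
    proof -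
      have "complex_of_real t ^ (i - 1) = of_real q powi int (\<tau> * (i - 1))"
        unfolding power_int_of_nat by (simp add: assms(5) power_mult)
      moreover have "of_real q powi m i = (of_real q powi \<nu> i * of_real q powi int (\<tau> * (i - 1)) :: complex)"
        using assms(1) by (subst power_int_add[symmetric]) (simp_all add: m[OF that])
      ultimately show ?thesis
        by (simp only: assms(11) mult_ac)
    qed
    then show "jackson_term q n \<tau> \<alpha> a\<^sub>1 b\<^sub>1 L (\<lambda>i. x * of_real t ^ (i - 1)) \<nu> = ?f m"
      using assms by (intro jackson_term_eq_lattice_term) auto
  qed (rule lattice_term_eq_0[OF assms(1,4)])
  with s have truncated: "(jackson_term q n \<tau> \<alpha> a\<^sub>1 b\<^sub>1 L (\<lambda>i. x * of_real t ^ (i - 1)) has_sum s)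
      (nondecreasing_int_vectors n)"
    by blast
  have "jackson_integral q n \<tau> \<alpha> a\<^sub>1 b\<^sub>1 L (\<lambda>i. x) = (1 - of_real q) ^ n * (fact n * s)"
    unfolding jackson_integral_def using full by (simp only: infsumI)
  moreover have "truncated_jackson_integral q n \<tau> \<alpha> a\<^sub>1 b\<^sub>1 L (\<lambda>i. x * of_real t ^ (i - 1)) = (1 - of_real q) ^ n * s"
    unfolding truncated_jackson_integral_def using truncated by (simp only: infsumI)
  ultimately show ?thesis
    using has_sum_imp_summable[OF full] has_sum_imp_summable[OF truncated] by simp
qed

end
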